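(* Consider binary-valued output processes $\{l^{(1)}(t)\in\{0,1\}\}_{t\in\mathbb{N}_0}$ and $\{l^{(2)}(t)\in\{0,1\}\}_{t\in\mathbb{N}_0}$ of time-inhomogeneous hidden Markov models such that $l^{(1)}\in\Gamma_{p_0^{(1)},p_1^{(1)}}$ and $l^{(2)}\in\Gamma_{p_0^{(2)},p_1^{(2)}}$ with $p_0^{(1)},p_1^{(1)},p_0^{(2)},p_1^{(2)}\in[0,1]$. Suppose that the Markov chains $\{\theta^{l^{(1)}}(t)\in\Theta^{l^{(1)}}\}_{t\in\mathbb{N}_0}$ and $\{\theta^{l^{(2)}}(t)\in\Theta^{l^{(2)}}\}_{t\in\mathbb{N}_0}$ associated with $l^{(1)}$ and $l^{(2)}$ are mutually independent. Let $$\tilde p_0\triangleq p_0^{(1)}p_0^{(2)},\qquad \tilde p_1\triangleq\min\{p_1^{(1)}+p_0^{(1)}p_1^{(2)},\;p_1^{(2)}+p_0^{(2)}p_1^{(1)},\;1\}.$$ Then the process $\{\tilde l(t)\in\{0,1\}\}_{t\in\mathbb{N}_0}$ defined by $\tilde l(t)=l^{(1)}(t)\vee l^{(2)}(t)$, $t\in\mathbb{N}_0$, is the output process of a time-inhomogeneous hidden Markov model, and moreover $\tilde l\in\Gamma_{\tilde p_0,\tilde p_1}$.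
   Context: All processes are defined on a common probability space $(\Omega,\mathcal{F},\mathbb{P})$ with filtration $\{\mathcal{F}_t\}_{t\in\mathbb{N}_0}$. $\vee$ denotes the or-operation on binary numbers. Hidden Markov models: a binary-valued process $\{l(t)\in\{0,1\}\}_{t\in\mathbb{N}_0}$ is the output process of a time-inhomogeneous hidden Markov model if $l(t)=h^l(\theta^l(t))$, $t\in\mathbb{N}_0$, where $h^l\colon\Theta^l\to\{0,1\}$ is a function on a finite set $\Theta^l$ and $\{\theta^l(t)\in\Theta^l\}_{t\in\mathbb{N}_0}$ is an $\mathcal{F}_t$-adapted, finite-state, time-inhomogeneous Markov chain with initial distribution $\vartheta^l_q\in[0,1]$, $q\in\Theta^l$, and time-varying transition probability functions $p^l_{q,r}\colon\mathbb{N}_0\to[0,1]$, $q,r\in\Theta^l$ (so $\sum_{r\in\Theta^l}p^l_{q,r}(t)=1$), satisfying $\mathbb{P}[\theta^l(0)=q]=\vartheta^l_q$ and $\mathbb{P}[\theta^l(t+1)=r\mid\theta^l(t)=q]=p^l_{q,r}(t)$. Put $\Theta^l_0\triangleq\{r\in\Theta^l\colon h^l(r)=0\}$ and $\Theta^l_1\triangleq\{r\in\Theta^l\colon h^l(r)=1\}$. Class $\Gamma_{p_0,p_1}$: for $p_0,p_1\in[0,1]$, $\Gamma_{p_0,p_1}$ is the class of output processes $l$ of time-inhomogeneous hidden Markov models such that $\sum_{r\in\Theta^l_0}p^l_{q,r}(t)\le p_0$ and $\sum_{r\in\Theta^l_1}p^l_{q,r}(t)\le p_1$ for all $q\in\Theta^l$,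 $t\in\mathbb{N}_0$. *)

theory Defs
  imports "HOL-Probability.Probability" "HOL-Library.Z2"
begin

unbundle bit_operations_syntax

text \<open>
  Binary values are elements of the type \<^typ>\<open>bit\<close>, whose only elements are \<open>0\<close> and \<open>1\<close>; the
  or-operation on binary numbers is \<open>OR\<close>.  A process is a function of time and outcome, and its
  values matter only on \<open>space M\<close>.
\<close>

definition filtered_prob_space :: "'w measure \<Rightarrow> (nat \<Rightarrow> 'w measure) \<Rightarrow> bool" where
  "filtered_prob_space M F \<longleftrightarrow>
     prob_space M \<and> filtration (space M) F \<and> (\<forall>t. subalgebra M (F t))"

text \<open>
  \<open>p q r t\<close> is the probability of a transition from \<open>q\<close> to \<open>r\<close> at time \<open>t\<close>.  Adaptedness (the first
  clause of the second block) includes that the chain takes its values in \<open>\<Theta>\<close>.  The Markov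
  property is the ordinary one, with respect to the past of the chain itself; \<open>F\<close> enters
  through adaptedness only.  Since \<^const>\<open>cond_prob\<close> is \<open>0\<close> when the conditioning event is null,
  the clauses about conditional probabilities are restricted to conditioning events of
  positive probability.
\<close>

definition markov_chain ::
  "'w measure \<Rightarrow> (nat \<Rightarrow> 'w measure) \<Rightarrow> 'a set \<Rightarrow> ('a \<Rightarrow> real) \<Rightarrow> ('a \<Rightarrow> 'a \<Rightarrow> nat \<Rightarrow> real) \<Rightarrow>
   (nat \<Rightarrow> 'w \<Rightarrow> 'a) \<Rightarrow> bool" where
  "markov_chain M F \<Theta> \<iota> p \<theta> \<longleftrightarrow>
     finite \<Theta> \<and>
     (\<forall>q\<in>\<Theta>. \<iota> q \<in> {0..1}) \<and>
     (\<forall>q\<in>\<Theta>. \<forall>r\<in>\<Theta>. \<forall>t. p q r t \<in> {0..1}) \<and>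
     (\<forall>q\<in>\<Theta>. \<forall>t. (\<Sum>r\<in>\<Theta>. p q r t) = 1) \<and>

     (\<forall>t. \<theta> t \<in> F t \<rightarrow>\<^sub>M count_space \<Theta>) \<and>
     (\<forall>q\<in>\<Theta>. \<P>(\<omega> in M. \<theta> 0 \<omega> = q) = \<iota> q) \<and>
     (\<forall>t. \<forall>q\<in>\<Theta>. \<forall>r\<in>\<Theta>. \<P>(\<omega> in M. \<theta> t \<omega> = q) > 0 \<longrightarrow>
        \<P>(\<omega> in M. \<theta> (t + 1) \<omega> = r \<bar> \<theta> t \<omega> = q) = p q r t) \<and>
     (\<forall>t. \<forall>x. \<forall>r\<in>\<Theta>. (\<forall>s\<le>t. x s \<in> \<Theta>) \<and> \<P>(\<omega> in M. \<forall>s\<le>t. \<theta> s \<omega> = x s) > 0 \<longrightarrow>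
        \<P>(\<omega> in M. \<theta> (t + 1) \<omega> = r \<bar> \<forall>s\<le>t. \<theta> s \<omega> = x s) =
        \<P>(\<omega> in M. \<theta> (t + 1) \<omega> = r \<bar> \<theta> t \<omega> = x t))"

definition hidden_markov_model ::
  "'w measure \<Rightarrow> (nat \<Rightarrow> 'w measure) \<Rightarrow> 'a set \<Rightarrow> ('a \<Rightarrow> real) \<Rightarrow> ('a \<Rightarrow> 'a \<Rightarrow> nat \<Rightarrow> real) \<Rightarrow>
   (nat \<Rightarrow> 'w \<Rightarrow> 'a) \<Rightarrow> ('a \<Rightarrow> bit) \<Rightarrow> (nat \<Rightarrow> 'w \<Rightarrow> bit) \<Rightarrow> bool" where
  "hidden_markov_model M F \<Theta> \<iota> p \<theta> h l \<longleftrightarrow>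
     markov_chain M F \<Theta> \<iota> p \<theta> \<and> (\<forall>t. \<forall>\<omega>\<in>space M. l t \<omega> = h (\<theta> t \<omega>))"

definition Gamma_bounds ::
  "'a set \<Rightarrow> ('a \<Rightarrow> 'a \<Rightarrow> nat \<Rightarrow> real) \<Rightarrow> ('a \<Rightarrow> bit) \<Rightarrow> real \<Rightarrow> real \<Rightarrow> bool" where
  "Gamma_bounds \<Theta> p h p0 p1 \<longleftrightarrow>
     (\<forall>q\<in>\<Theta>. \<forall>t. (\<Sum>r\<in>{r\<in>\<Theta>. h r = 0}. p q r t) \<le> p0 \<and> (\<Sum>r\<in>{r\<in>\<Theta>. h r = 1}. p q r t) \<le> p1)"

text \<open>
  One cannot quantify existentially over the type of the states.  As the state space is finite,
  it may be taken to be a set of natural numbers; lemmas \<open>hmm_output_processI\<close> and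
  \<open>Gamma_processesI\<close> show that models with states of any other type yield the same processes.
\<close>

definition hmm_output_process ::
  "'w measure \<Rightarrow> (nat \<Rightarrow> 'w measure) \<Rightarrow> (nat \<Rightarrow> 'w \<Rightarrow> bit) \<Rightarrow> bool" where
  "hmm_output_process M F l \<longleftrightarrow>
     (\<exists>(\<Theta> :: nat set) \<iota> p \<theta> h. hidden_markov_model M F \<Theta> \<iota> p \<theta> h l)"

definition Gamma_processes ::
  "'w measure \<Rightarrow> (nat \<Rightarrow> 'w measure) \<Rightarrow> real \<Rightarrow> real \<Rightarrow> (nat \<Rightarrow> 'w \<Rightarrow> bit) set" where
  "Gamma_processes M F p0 p1 =
     {l. \<exists>(\<Theta> :: nat set) \<iota> p \<theta> h. hidden_markov_model M F \<Theta> \<iota> p \<theta> h l \<and> Gamma_bounds \<Theta> p h p0 p1}"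

text \<open>
  The \<open>\<sigma>\<close>-algebra generated by the whole process.  Independence of two processes is independence
  of these \<open>\<sigma>\<close>-algebras (\<^const>\<open>prob_space.indep_var\<close> would force both state spaces into one type).
\<close>

definition process_sigma :: "'w measure \<Rightarrow> 'a set \<Rightarrow> (nat \<Rightarrow> 'w \<Rightarrow> 'a) \<Rightarrow> 'w set set" where
  "process_sigma M \<Theta> \<theta> = sigma_sets (space M) {\<theta> t -` A \<inter> space M | t A. A \<subseteq> \<Theta>}"

definition indep_processes ::
  "'w measure \<Rightarrow> 'a set \<Rightarrow> (nat \<Rightarrow> 'w \<Rightarrow> 'a) \<Rightarrow> 'b set \<Rightarrow> (nat \<Rightarrow> 'w \<Rightarrow> 'b) \<Rightarrow> bool" where
  "indep_processes M \<Theta>\<^sub>1 \<theta>\<^sub>1 \<Theta>\<^sub>2 \<theta>\<^sub>2 \<longleftrightarrow>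
     prob_space.indep_set M (process_sigma M \<Theta>\<^sub>1 \<theta>\<^sub>1) (process_sigma M \<Theta>\<^sub>2 \<theta>\<^sub>2)"

lemma hidden_markov_model_rename:
  fixes f :: "'a \<Rightarrow> 'b"
  assumes fil: "filtered_prob_space M F"
    and hmm: "hidden_markov_model M F \<Theta> \<iota> p \<theta> h l"
    and inj: "inj_on f \<Theta>"
  defines "g \<equiv> the_inv_into \<Theta> f"
  shows "hidden_markov_model M F (f ` \<Theta>) (\<lambda>q. \<iota> (g q)) (\<lambda>q r. p (g q) (g r))
           (\<lambda>t \<omega>. f (\<theta> t \<omega>)) (\<lambda>q. h (g q)) l"
proof -
  have gf [simp]: "g (f q) = q" if "q \<in> \<Theta>" for q
    using that inj by (simp add: g_def the_inv_into_f_f)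
  have mc: "markov_chain M F \<Theta> \<iota> p \<theta>" and l: "\<And>t \<omega>. \<omega> \<in> space M \<Longrightarrow> l t \<omega> = h (\<theta> t \<omega>)"
    using hmm by (auto simp: hidden_markov_model_def)
  have meas: "\<theta> t \<in> F t \<rightarrow>\<^sub>M count_space \<Theta>" for t
    using mc by (simp add: markov_chain_def)
  have sp: "space (F t) = space M" for t
    using fil by (simp add: filtered_prob_space_def subalgebra_def)
  have val: "\<theta> t \<omega> \<in> \<Theta>" if "\<omega> \<in> space M" for t \<omega>
    using measurable_space[OF meas, of \<omega> t] that sp by simp
  have eq: "f (\<theta> t \<omega>) = f q \<longleftrightarrow> \<theta> t \<omega> = q" if "\<omega> \<in> space M" "q \<in> \<Theta>" for t \<omega> q
    using val[OF that(1)] that(2) inj by (auto simp: inj_on_def)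
  have e1: "\<P>(\<omega> in M. f (\<theta> t \<omega>) = f q) = \<P>(\<omega> in M. \<theta> t \<omega> = q)" if "q \<in> \<Theta>" for t q
    using that eq by (intro arg_cong[where f = "measure M"]) auto
  have e2: "cond_prob M (\<lambda>\<omega>. f (\<theta> (t + 1) \<omega>) = f r) (\<lambda>\<omega>. f (\<theta> t \<omega>) = f q) =
      cond_prob M (\<lambda>\<omega>. \<theta> (t + 1) \<omega> = r) (\<lambda>\<omega>. \<theta> t \<omega> = q)" if "q \<in> \<Theta>" "r \<in> \<Theta>" for t q r
    unfolding cond_prob_def using that eq
    by (intro arg_cong2[where f = "(/)"] arg_cong[where f = "measure M"]) auto
  have e3: "{\<omega> \<in> space M. \<forall>s\<le>t. f (\<theta> s \<omega>) = x s} = {\<omega> \<in> space M. \<forall>s\<le>t. \<theta> s \<omega> = g (x s)}"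
    and e4: "{\<omega> \<in> space M. f (\<theta> (t + 1) \<omega>) = f r \<and> (\<forall>s\<le>t. f (\<theta> s \<omega>) = x s)} =
      {\<omega> \<in> space M. \<theta> (t + 1) \<omega> = r \<and> (\<forall>s\<le>t. \<theta> s \<omega> = g (x s))}"
    if "\<forall>s\<le>t. x s \<in> f ` \<Theta>" "r \<in> \<Theta>" for t x r
  proof -
    have *: "f (\<theta> s \<omega>) = x s \<longleftrightarrow> \<theta> s \<omega> = g (x s)" if "\<omega> \<in> space M" "s \<le> t" for s \<omega>
    proof -
      obtain q where "q \<in> \<Theta>" "x s = f q" using \<open>\<forall>s\<le>t. x s \<in> f ` \<Theta>\<close> \<open>s \<le> t\<close> by auto
      then show ?thesis using eq[OF \<open>\<omega> \<in> space M\<close>, of q s] by simp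
    qed
    show "{\<omega> \<in> space M. \<forall>s\<le>t. f (\<theta> s \<omega>) = x s} = {\<omega> \<in> space M. \<forall>s\<le>t. \<theta> s \<omega> = g (x s)}"
      using * by auto
    show "{\<omega> \<in> space M. f (\<theta> (t + 1) \<omega>) = f r \<and> (\<forall>s\<le>t. f (\<theta> s \<omega>) = x s)} =
      {\<omega> \<in> space M. \<theta> (t + 1) \<omega> = r \<and> (\<forall>s\<le>t. \<theta> s \<omega> = g (x s))}"
    proof (rule Collect_cong)
      show "(\<omega> \<in> space M \<and> f (\<theta> (t + 1) \<omega>) = f r \<and> (\<forall>s\<le>t. f (\<theta> s \<omega>) = x s)) \<longleftrightarrow>
        (\<omega> \<in> space M \<and> \<theta> (t + 1) \<omega> = r \<and> (\<forall>s\<le>t. \<theta> s \<omega> = g (x s)))" for \<omega>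
        using *[of \<omega>] eq[OF _ that(2), of \<omega> "t + 1"] by blast
    qed
  qed
  have sum_eq: "(\<Sum>r\<in>f ` \<Theta>. p q (g r) t) = (\<Sum>r\<in>\<Theta>. p q r t)" for q t
    using inj by (simp add: sum.reindex)
  have meas': "(\<lambda>\<omega>. f (\<theta> t \<omega>)) \<in> F t \<rightarrow>\<^sub>M count_space (f ` \<Theta>)" for t
    by (rule measurable_compose[OF meas]) auto
  have markov: "\<P>(\<omega> in M. f (\<theta> (t + 1) \<omega>) = f r \<bar> \<forall>s\<le>t. f (\<theta> s \<omega>) = x s) =
        \<P>(\<omega> in M. f (\<theta> (t + 1) \<omega>) = f r \<bar> f (\<theta> t \<omega>) = x t)"
    if r: "r \<in> \<Theta>" and x: "\<forall>s\<le>t. x s \<in> f ` \<Theta>"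
      and pos: "\<P>(\<omega> in M. \<forall>s\<le>t. f (\<theta> s \<omega>) = x s) > 0" for t x r
  proof -
    have gx: "\<forall>s\<le>t. g (x s) \<in> \<Theta>" using x by force
    have fx: "x t = f (g (x t))" using x by force
    have pos': "\<P>(\<omega> in M. \<forall>s\<le>t. \<theta> s \<omega> = g (x s)) > 0" using pos e3[OF x r] by simp
    have "\<P>(\<omega> in M. f (\<theta> (t + 1) \<omega>) = f r \<bar> \<forall>s\<le>t. f (\<theta> s \<omega>) = x s) =
        \<P>(\<omega> in M. \<theta> (t + 1) \<omega> = r \<bar> \<forall>s\<le>t. \<theta> s \<omega> = g (x s))"
      unfolding cond_prob_def e3[OF x r] e4[OF x r] ..
    also have "\<dots> = \<P>(\<omega> in M. \<theta> (t + 1) \<omega> = r \<bar> \<theta> t \<omega> = g (x t))"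
    proof -
      have "\<forall>t. \<forall>x. \<forall>r\<in>\<Theta>. (\<forall>s\<le>t. x s \<in> \<Theta>) \<and> \<P>(\<omega> in M. \<forall>s\<le>t. \<theta> s \<omega> = x s) > 0 \<longrightarrow>
        \<P>(\<omega> in M. \<theta> (t + 1) \<omega> = r \<bar> \<forall>s\<le>t. \<theta> s \<omega> = x s) =
        \<P>(\<omega> in M. \<theta> (t + 1) \<omega> = r \<bar> \<theta> t \<omega> = x t)"
        using mc unfolding markov_chain_def by blast
      from this[rule_format, of r t "\<lambda>s. g (x s)"] show ?thesis using r gx pos' by simp
    qed
    also have "\<dots> = \<P>(\<omega> in M. f (\<theta> (t + 1) \<omega>) = f r \<bar> f (\<theta> t \<omega>) = f (g (x t)))"
      using e2[of "g (x t)" r t] gx r by simp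
    finally show ?thesis using fx by simp
  qed
  have trans: "\<P>(\<omega> in M. f (\<theta> (t + 1) \<omega>) = f r \<bar> f (\<theta> t \<omega>) = f q) = p q r t"
    if "q \<in> \<Theta>" "r \<in> \<Theta>" "\<P>(\<omega> in M. f (\<theta> t \<omega>) = f q) > 0" for t q r
    using mc that e1[of q t] e2[of q r t] unfolding markov_chain_def by simp
  have "markov_chain M F (f ` \<Theta>) (\<lambda>q. \<iota> (g q)) (\<lambda>q r. p (g q) (g r)) (\<lambda>t \<omega>. f (\<theta> t \<omega>))"
    unfolding markov_chain_def
  proof (intro conjI)
    show "\<forall>t x. \<forall>r\<in>f ` \<Theta>. (\<forall>s\<le>t. x s \<in> f ` \<Theta>) \<and> 0 < \<P>(\<omega> in M. \<forall>s\<le>t. f (\<theta> s \<omega>) = x s) \<longrightarrow>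
        \<P>(\<omega> in M. f (\<theta> (t + 1) \<omega>) = r \<bar> \<forall>s\<le>t. f (\<theta> s \<omega>) = x s) =
        \<P>(\<omega> in M. f (\<theta> (t + 1) \<omega>) = r \<bar> f (\<theta> t \<omega>) = x t)"
      using markov by blast
    show "\<forall>t. \<forall>q\<in>f ` \<Theta>. \<forall>r\<in>f ` \<Theta>. 0 < \<P>(\<omega> in M. f (\<theta> t \<omega>) = q) \<longrightarrow>
        \<P>(\<omega> in M. f (\<theta> (t + 1) \<omega>) = r \<bar> f (\<theta> t \<omega>) = q) = p (g q) (g r) t"
      using trans by auto
  qed (use mc meas' sum_eq e1 in \<open>auto simp: markov_chain_def\<close>)
  then show ?thesis
    unfolding hidden_markov_model_def using l val by simp
qed

lemma hmm_output_processI: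
  fixes \<Theta> :: "'a set"
  assumes fil: "filtered_prob_space M F" and hmm: "hidden_markov_model M F \<Theta> \<iota> p \<theta> h l"
  shows "hmm_output_process M F l"
proof -
  have "finite \<Theta>" using hmm by (simp add: hidden_markov_model_def markov_chain_def)
  then obtain f :: "'a \<Rightarrow> nat" where "inj_on f \<Theta>" using finite_imp_inj_to_nat_seg by metis
  from hidden_markov_model_rename[OF fil hmm this] show ?thesis
    unfolding hmm_output_process_def by blast
qed

lemma Gamma_processesI:
  fixes \<Theta> :: "'a set"
  assumes fil: "filtered_prob_space M F" and hmm: "hidden_markov_model M F \<Theta> \<iota> p \<theta> h l"
    and bounds: "Gamma_bounds \<Theta> p h p0 p1"
  shows "l \<in> Gamma_processes M F p0 p1"
proof -
  have "finite \<Theta>" using hmm by (simp add: hidden_markov_model_def markov_chain_def)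
  then obtain f :: "'a \<Rightarrow> nat" where f: "inj_on f \<Theta>" using finite_imp_inj_to_nat_seg by metis
  define g where "g = the_inv_into \<Theta> f"
  have gf: "g (f q) = q" if "q \<in> \<Theta>" for q
    using that f by (simp add: g_def the_inv_into_f_f)
  have "(\<Sum>r\<in>{r \<in> f ` \<Theta>. h (g r) = b}. p q (g r) t) = (\<Sum>r\<in>{r\<in>\<Theta>. h r = b}. p q r t)" for b q t
  proof -
    have "{r \<in> f ` \<Theta>. h (g r) = b} = f ` {r\<in>\<Theta>. h r = b}" using gf by auto
    moreover have "inj_on f {r\<in>\<Theta>. h r = b}" using f by (rule inj_on_subset) auto
    ultimately show ?thesis using gf by (simp add: sum.reindex)
  qed
  then have "Gamma_bounds (f ` \<Theta>) (\<lambda>q r. p (g q) (g r)) (\<lambda>q. h (g q)) p0 p1"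
    using bounds gf by (simp add: Gamma_bounds_def)
  with hidden_markov_model_rename[OF fil hmm f] show ?thesis
    unfolding Gamma_processes_def g_def by blast
qed

end

theory Submission
  imports Defs
begin

text \<open>
  The pair of the two chains is itself a Markov chain on \<open>\<Theta>\<^sub>1 \<times> \<Theta>\<^sub>2\<close>: by independence its conditional
  probabilities factor, and so do its transition probabilities.  With \<open>a\<^sub>b\<close> and \<open>c\<^sub>b\<close> the probabilities
  that the two outputs jump to \<open>b\<close>, the disjunction jumps to \<open>0\<close> with probability \<open>a\<^sub>0 c\<^sub>0\<close> and to \<open>1\<close>
  with probability \<open>a\<^sub>1 + a\<^sub>0 c\<^sub>1 = c\<^sub>1 + c\<^sub>0 a\<^sub>1\<close>.
\<close>

lemma sigma_algebra_process_sigma: "sigma_algebra (space M) (process_sigma M \<Theta> \<theta>)"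
  unfolding process_sigma_def by (rule sigma_algebra_sigma_sets) auto

lemma process_sigma_eq:
  assumes "q \<in> \<Theta>"
  shows "{\<omega> \<in> space M. \<theta> t \<omega> = q} \<in> process_sigma M \<Theta> \<theta>"
proof -
  have "{\<omega> \<in> space M. \<theta> t \<omega> = q} = \<theta> t -` {q} \<inter> space M" by auto
  then show ?thesis
    unfolding process_sigma_def using assms by (intro sigma_sets.Basic) blast
qed

text \<open>A path up to a finite time is a finite intersection of one-time events. This makes the
  conditioning events of the Markov property accessible to independence.\<close>

lemma process_sigma_path:
  assumes "\<forall>s\<le>t. x s \<in> \<Theta>"
  shows "{\<omega> \<in> space M. \<forall>s\<le>(t::nat). \<theta> s \<omega> = x s} \<in> process_sigma M \<Theta> \<theta>"
proof -
  interpret S: sigma_algebra "space M" "process_sigma M \<Theta> \<theta>"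
    by (rule sigma_algebra_process_sigma)
  have "{\<omega> \<in> space M. \<forall>s\<in>{..t}. \<theta> s \<omega> = x s} \<in> process_sigma M \<Theta> \<theta>"
    using assms by (intro S.sets_Collect_finite_All process_sigma_eq) auto
  then show ?thesis by (simp add: Ball_def)
qed

text \<open>Independence speaks of sets, whereas \<open>cond_prob\<close> unfolds to events given by
  predicates; this is the bridge.\<close>

lemma (in prob_space) indep_prob_conj:
  assumes "indep_set A B"
    and "{\<omega> \<in> space M. P \<omega>} \<in> A" "{\<omega> \<in> space M. Q \<omega>} \<in> B"
  shows "\<P>(\<omega> in M. P \<omega> \<and> Q \<omega>) = \<P>(\<omega> in M. P \<omega>) * \<P>(\<omega> in M. Q \<omega>)"
proof -
  have "{\<omega> \<in> space M. P \<omega> \<and> Q \<omega>} = {\<omega> \<in> space M. P \<omega>} \<inter> {\<omega> \<in> space M. Q \<omega>}" by auto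
  then show ?thesis using indep_setD[OF assms] by simp
qed

text \<open>After regrouping, the numerator is the probability of an event of \<open>A\<close> and
  an event of \<open>B\<close>, so numerator and denominator both factor. Closure of
  \<open>A\<close> and \<open>B\<close> under intersection is what keeps the regrouped events inside
  them. If a conditioning event is null, both sides are 0 by the convention for division by zero, so
  positivity need not be carried along.\<close>

lemma (in prob_space) indep_cond_prob_conj:
  assumes ind: "indep_set A B" and A: "sigma_algebra (space M) A" and B: "sigma_algebra (space M) B"
    and P: "{\<omega> \<in> space M. P \<omega>} \<in> A" "{\<omega> \<in> space M. P' \<omega>} \<in> A"
    and Q: "{\<omega> \<in> space M. Q \<omega>} \<in> B" "{\<omega> \<in> space M. Q' \<omega>} \<in> B"
  shows "\<P>(\<omega> in M. P \<omega> \<and> Q \<omega> \<bar> P' \<omega> \<and> Q' \<omega>) =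
    \<P>(\<omega> in M. P \<omega> \<bar> P' \<omega>) * \<P>(\<omega> in M. Q \<omega> \<bar> Q' \<omega>)"
proof -
  interpret A: sigma_algebra "space M" A by fact
  interpret B: sigma_algebra "space M" B by fact
  have "\<P>(\<omega> in M. (P \<omega> \<and> Q \<omega>) \<and> P' \<omega> \<and> Q' \<omega>) = \<P>(\<omega> in M. (P \<omega> \<and> P' \<omega>) \<and> Q \<omega> \<and> Q' \<omega>)"
    by (intro arg_cong[where f = "measure M"]) auto
  also have "\<dots> = \<P>(\<omega> in M. P \<omega> \<and> P' \<omega>) * \<P>(\<omega> in M. Q \<omega> \<and> Q' \<omega>)"
    by (intro indep_prob_conj[OF ind] A.sets_Collect_conj B.sets_Collect_conj P Q)
  finally show ?thesis
    unfolding cond_prob_def using indep_prob_conj[OF ind P(2) Q(2)] by simp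
qed

text \<open>The Markov property involves the path up to time \<open>t\<close> together with the
  state at \<open>t + 1\<close>. Independence is therefore applied to events of the whole processes,
  not just to states at a single time.\<close>

lemma markov_chain_pair:
  assumes fil: "filtered_prob_space M F"
    and mc1: "markov_chain M F \<Theta>\<^sub>1 \<iota>\<^sub>1 P\<^sub>1 \<theta>\<^sub>1" and mc2: "markov_chain M F \<Theta>\<^sub>2 \<iota>\<^sub>2 P\<^sub>2 \<theta>\<^sub>2"
    and indep: "indep_processes M \<Theta>\<^sub>1 \<theta>\<^sub>1 \<Theta>\<^sub>2 \<theta>\<^sub>2"
  shows "markov_chain M F (\<Theta>\<^sub>1 \<times> \<Theta>\<^sub>2) (\<lambda>q. \<iota>\<^sub>1 (fst q) * \<iota>\<^sub>2 (snd q))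
    (\<lambda>q r t. P\<^sub>1 (fst q) (fst r) t * P\<^sub>2 (snd q) (snd r) t) (\<lambda>t \<omega>. (\<theta>\<^sub>1 t \<omega>, \<theta>\<^sub>2 t \<omega>))"
proof -
  interpret prob_space M using fil by (simp add: filtered_prob_space_def)
  have ind: "indep_set (process_sigma M \<Theta>\<^sub>1 \<theta>\<^sub>1) (process_sigma M \<Theta>\<^sub>2 \<theta>\<^sub>2)"
    using indep by (simp add: indep_processes_def)
  note prob_conj = indep_prob_conj[OF ind]
    and cond_conj = indep_cond_prob_conj[OF ind sigma_algebra_process_sigma sigma_algebra_process_sigma]
  have fin: "finite \<Theta>\<^sub>1" "finite \<Theta>\<^sub>2"
    using mc1 mc2 by (simp_all add: markov_chain_def)
  have meas: "\<theta>\<^sub>1 t \<in> F t \<rightarrow>\<^sub>M count_space \<Theta>\<^sub>1" "\<theta>\<^sub>2 t \<in> F t \<rightarrow>\<^sub>M count_space \<Theta>\<^sub>2" for t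
    using mc1 mc2 by (simp_all add: markov_chain_def)
  have trans1: "\<P>(\<omega> in M. \<theta>\<^sub>1 (t + 1) \<omega> = r \<bar> \<theta>\<^sub>1 t \<omega> = q) = P\<^sub>1 q r t"
    if "q \<in> \<Theta>\<^sub>1" "r \<in> \<Theta>\<^sub>1" "\<P>(\<omega> in M. \<theta>\<^sub>1 t \<omega> = q) > 0" for t q r
    using mc1 that unfolding markov_chain_def by blast
  have trans2: "\<P>(\<omega> in M. \<theta>\<^sub>2 (t + 1) \<omega> = r \<bar> \<theta>\<^sub>2 t \<omega> = q) = P\<^sub>2 q r t"
    if "q \<in> \<Theta>\<^sub>2" "r \<in> \<Theta>\<^sub>2" "\<P>(\<omega> in M. \<theta>\<^sub>2 t \<omega> = q) > 0" for t q r
    using mc2 that unfolding markov_chain_def by blast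
  have markov1: "\<P>(\<omega> in M. \<theta>\<^sub>1 (t + 1) \<omega> = r \<bar> \<forall>s\<le>t. \<theta>\<^sub>1 s \<omega> = x s) =
      \<P>(\<omega> in M. \<theta>\<^sub>1 (t + 1) \<omega> = r \<bar> \<theta>\<^sub>1 t \<omega> = x t)"
    if "r \<in> \<Theta>\<^sub>1" "\<forall>s\<le>t. x s \<in> \<Theta>\<^sub>1" "\<P>(\<omega> in M. \<forall>s\<le>t. \<theta>\<^sub>1 s \<omega> = x s) > 0" for t x r
    using mc1 that unfolding markov_chain_def by blast
  have markov2: "\<P>(\<omega> in M. \<theta>\<^sub>2 (t + 1) \<omega> = r \<bar> \<forall>s\<le>t. \<theta>\<^sub>2 s \<omega> = x s) =
      \<P>(\<omega> in M. \<theta>\<^sub>2 (t + 1) \<omega> = r \<bar> \<theta>\<^sub>2 t \<omega> = x t)"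
    if "r \<in> \<Theta>\<^sub>2" "\<forall>s\<le>t. x s \<in> \<Theta>\<^sub>2" "\<P>(\<omega> in M. \<forall>s\<le>t. \<theta>\<^sub>2 s \<omega> = x s) > 0" for t x r
    using mc2 that unfolding markov_chain_def by blast
  \<comment> \<open>Each chain guards its clauses by positivity of its own conditioning event. The
    joint probability is a product of nonnegative numbers, so its positivity passes to both
    factors.\<close>
  have pos: "a > 0" "b > 0" if "a * b > 0" "a \<ge> 0" "b \<ge> 0" for a b :: real
    using that by (auto simp: zero_less_mult_iff)
  have prob_state: "\<P>(\<omega> in M. (\<theta>\<^sub>1 t \<omega>, \<theta>\<^sub>2 t \<omega>) = q) =
      \<P>(\<omega> in M. \<theta>\<^sub>1 t \<omega> = fst q) * \<P>(\<omega> in M. \<theta>\<^sub>2 t \<omega> = snd q)"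
    if "q \<in> \<Theta>\<^sub>1 \<times> \<Theta>\<^sub>2" for t q
    unfolding prod_eq_iff fst_conv snd_conv using that
    by (intro prob_conj process_sigma_eq) auto
  have cond_state: "\<P>(\<omega> in M. (\<theta>\<^sub>1 (t + 1) \<omega>, \<theta>\<^sub>2 (t + 1) \<omega>) = r \<bar> (\<theta>\<^sub>1 t \<omega>, \<theta>\<^sub>2 t \<omega>) = q) =
      \<P>(\<omega> in M. \<theta>\<^sub>1 (t + 1) \<omega> = fst r \<bar> \<theta>\<^sub>1 t \<omega> = fst q) *
      \<P>(\<omega> in M. \<theta>\<^sub>2 (t + 1) \<omega> = snd r \<bar> \<theta>\<^sub>2 t \<omega> = snd q)"
    if "q \<in> \<Theta>\<^sub>1 \<times> \<Theta>\<^sub>2" "r \<in> \<Theta>\<^sub>1 \<times> \<Theta>\<^sub>2" for t q r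
    unfolding prod_eq_iff fst_conv snd_conv using that
    by (intro cond_conj process_sigma_eq) auto
  \<comment> \<open>A joint path event is the intersection of one path event per chain, each in the
    corresponding generated sigma-algebra.\<close>
  have path: "(\<forall>s\<le>t. (\<theta>\<^sub>1 s \<omega>, \<theta>\<^sub>2 s \<omega>) = x s) \<longleftrightarrow>
      (\<forall>s\<le>t. \<theta>\<^sub>1 s \<omega> = fst (x s)) \<and> (\<forall>s\<le>t. \<theta>\<^sub>2 s \<omega> = snd (x s))" for t x \<omega>
    by (auto simp: prod_eq_iff)
  have trans: "\<P>(\<omega> in M. (\<theta>\<^sub>1 (t + 1) \<omega>, \<theta>\<^sub>2 (t + 1) \<omega>) = r \<bar> (\<theta>\<^sub>1 t \<omega>, \<theta>\<^sub>2 t \<omega>) = q) =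
      P\<^sub>1 (fst q) (fst r) t * P\<^sub>2 (snd q) (snd r) t"
    if qr: "q \<in> \<Theta>\<^sub>1 \<times> \<Theta>\<^sub>2" "r \<in> \<Theta>\<^sub>1 \<times> \<Theta>\<^sub>2" and p: "\<P>(\<omega> in M. (\<theta>\<^sub>1 t \<omega>, \<theta>\<^sub>2 t \<omega>) = q) > 0"
    for t q r
  proof -
    note pos' = pos[OF p[unfolded prob_state[OF qr(1)]] measure_nonneg measure_nonneg]
    show ?thesis
      unfolding cond_state[OF qr]
      by (intro arg_cong2[where f = "(*)"] trans1 trans2 pos') (use qr in auto)
  qed
  have markov: "\<P>(\<omega> in M. (\<theta>\<^sub>1 (t + 1) \<omega>, \<theta>\<^sub>2 (t + 1) \<omega>) = r \<bar> \<forall>s\<le>t. (\<theta>\<^sub>1 s \<omega>, \<theta>\<^sub>2 s \<omega>) = x s) =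
      \<P>(\<omega> in M. (\<theta>\<^sub>1 (t + 1) \<omega>, \<theta>\<^sub>2 (t + 1) \<omega>) = r \<bar> (\<theta>\<^sub>1 t \<omega>, \<theta>\<^sub>2 t \<omega>) = x t)"
    if r: "r \<in> \<Theta>\<^sub>1 \<times> \<Theta>\<^sub>2" and x: "\<forall>s\<le>t. x s \<in> \<Theta>\<^sub>1 \<times> \<Theta>\<^sub>2"
      and p: "\<P>(\<omega> in M. \<forall>s\<le>t. (\<theta>\<^sub>1 s \<omega>, \<theta>\<^sub>2 s \<omega>) = x s) > 0" for t x r
  proof -
    have r': "fst r \<in> \<Theta>\<^sub>1" "snd r \<in> \<Theta>\<^sub>2" using r by auto
    have x': "\<forall>s\<le>t. fst (x s) \<in> \<Theta>\<^sub>1" "\<forall>s\<le>t. snd (x s) \<in> \<Theta>\<^sub>2"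
      using x by (auto simp: mem_Times_iff)
    have "\<P>(\<omega> in M. \<forall>s\<le>t. (\<theta>\<^sub>1 s \<omega>, \<theta>\<^sub>2 s \<omega>) = x s) =
        \<P>(\<omega> in M. \<forall>s\<le>t. \<theta>\<^sub>1 s \<omega> = fst (x s)) * \<P>(\<omega> in M. \<forall>s\<le>t. \<theta>\<^sub>2 s \<omega> = snd (x s))"
      unfolding path by (intro prob_conj process_sigma_path x')
    note pos' = pos[OF p[unfolded this] measure_nonneg measure_nonneg]
    have "\<P>(\<omega> in M. (\<theta>\<^sub>1 (t + 1) \<omega>, \<theta>\<^sub>2 (t + 1) \<omega>) = r \<bar> \<forall>s\<le>t. (\<theta>\<^sub>1 s \<omega>, \<theta>\<^sub>2 s \<omega>) = x s) =
        \<P>(\<omega> in M. \<theta>\<^sub>1 (t + 1) \<omega> = fst r \<bar> \<forall>s\<le>t. \<theta>\<^sub>1 s \<omega> = fst (x s)) *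
        \<P>(\<omega> in M. \<theta>\<^sub>2 (t + 1) \<omega> = snd r \<bar> \<forall>s\<le>t. \<theta>\<^sub>2 s \<omega> = snd (x s))"
      \<comment> \<open>The order matters: \<open>prod_eq_iff\<close> would also split the equations
        under the quantifier, and \<open>path\<close> would no longer match.\<close>
      unfolding path unfolding prod_eq_iff fst_conv snd_conv
      by (intro cond_conj process_sigma_eq process_sigma_path r' x')
    also have "\<dots> = \<P>(\<omega> in M. \<theta>\<^sub>1 (t + 1) \<omega> = fst r \<bar> \<theta>\<^sub>1 t \<omega> = fst (x t)) *
        \<P>(\<omega> in M. \<theta>\<^sub>2 (t + 1) \<omega> = snd r \<bar> \<theta>\<^sub>2 t \<omega> = snd (x t))"
      using markov1[of "fst r" t "\<lambda>s. fst (x s)"] markov2[of "snd r" t "\<lambda>s. snd (x s)"] r' x' pos'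
      by simp
    \<comment> \<open>The factorization \<open>cond_state\<close> is read from right to left. It
      carries no positivity condition, so the probability of the joint state at time
      \<open>t\<close> need not be examined.\<close>
    also have "\<dots> = \<P>(\<omega> in M. (\<theta>\<^sub>1 (t + 1) \<omega>, \<theta>\<^sub>2 (t + 1) \<omega>) = r \<bar> (\<theta>\<^sub>1 t \<omega>, \<theta>\<^sub>2 t \<omega>) = x t)"
      using cond_state r x by simp
    finally show ?thesis .
  qed
  \<comment> \<open>For finite state spaces the product of the two counting spaces is the counting
    space of the product.\<close>
  have adapted: "(\<lambda>\<omega>. (\<theta>\<^sub>1 t \<omega>, \<theta>\<^sub>2 t \<omega>)) \<in> F t \<rightarrow>\<^sub>M count_space (\<Theta>\<^sub>1 \<times> \<Theta>\<^sub>2)" for t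
    using measurable_Pair[OF meas] fin by (simp add: pair_measure_count_space)
  have init: "\<P>(\<omega> in M. (\<theta>\<^sub>1 0 \<omega>, \<theta>\<^sub>2 0 \<omega>) = q) = \<iota>\<^sub>1 (fst q) * \<iota>\<^sub>2 (snd q)"
    if "q \<in> \<Theta>\<^sub>1 \<times> \<Theta>\<^sub>2" for q
    using mc1 mc2 that prob_state[OF that, of 0] unfolding markov_chain_def by auto
  \<comment> \<open>Rows must sum to 1 even at joint states of probability 0, where the process says
    nothing about the transition function. Hence this comes from the rows of
    \<open>P\<^sub>1\<close> and \<open>P\<^sub>2\<close>, by distributing the product of their
    sums.\<close>
  have total: "(\<Sum>r\<in>\<Theta>\<^sub>1 \<times> \<Theta>\<^sub>2. P\<^sub>1 (fst q) (fst r) t * P\<^sub>2 (snd q) (snd r) t) = 1"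
    if "q \<in> \<Theta>\<^sub>1 \<times> \<Theta>\<^sub>2" for q t
  proof -
    have "(\<Sum>r\<in>\<Theta>\<^sub>1 \<times> \<Theta>\<^sub>2. P\<^sub>1 (fst q) (fst r) t * P\<^sub>2 (snd q) (snd r) t) =
        (\<Sum>r\<in>\<Theta>\<^sub>1. P\<^sub>1 (fst q) r t) * (\<Sum>r\<in>\<Theta>\<^sub>2. P\<^sub>2 (snd q) r t)"
      by (simp add: sum_product sum.cartesian_product case_prod_beta)
    then show ?thesis using mc1 mc2 that by (auto simp: markov_chain_def)
  qed
  have unit: "a * b \<in> {0..1}" if "a \<in> {0..1}" "b \<in> {0..1}" for a b :: real
    using that by (simp add: mult_le_one)
  show ?thesis
    unfolding markov_chain_def
  proof (intro conjI)
    show "\<forall>q\<in>\<Theta>\<^sub>1 \<times> \<Theta>\<^sub>2. \<iota>\<^sub>1 (fst q) * \<iota>\<^sub>2 (snd q) \<in> {0..1}"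
      by (intro ballI unit) (use mc1 mc2 in \<open>auto simp: markov_chain_def\<close>)
    show "\<forall>q\<in>\<Theta>\<^sub>1 \<times> \<Theta>\<^sub>2. \<forall>r\<in>\<Theta>\<^sub>1 \<times> \<Theta>\<^sub>2. \<forall>t. P\<^sub>1 (fst q) (fst r) t * P\<^sub>2 (snd q) (snd r) t \<in> {0..1}"
      by (intro ballI allI unit) (use mc1 mc2 in \<open>auto simp: markov_chain_def\<close>)
  qed (use fin adapted init total trans markov in blast)+
qed

text \<open>The joint states with output 0 form a rectangle, so their mass is a product of sums.
  Those with output 1 do not, and their mass is found by complement. The Markov chain hypotheses
  supply finiteness, nonnegativity and row sums.\<close>

lemma Gamma_bounds_OR:
  assumes mc1: "markov_chain M F \<Theta>\<^sub>1 \<iota>\<^sub>1 P\<^sub>1 \<theta>\<^sub>1" and mc2: "markov_chain M F \<Theta>\<^sub>2 \<iota>\<^sub>2 P\<^sub>2 \<theta>\<^sub>2"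
    and G1: "Gamma_bounds \<Theta>\<^sub>1 P\<^sub>1 h\<^sub>1 p01 p11" and G2: "Gamma_bounds \<Theta>\<^sub>2 P\<^sub>2 h\<^sub>2 p02 p12"
  shows "Gamma_bounds (\<Theta>\<^sub>1 \<times> \<Theta>\<^sub>2) (\<lambda>q r t. P\<^sub>1 (fst q) (fst r) t * P\<^sub>2 (snd q) (snd r) t)
    (\<lambda>q. h\<^sub>1 (fst q) OR h\<^sub>2 (snd q)) (p01 * p02)
    (min (min (p11 + p01 * p12) (p12 + p02 * p11)) 1)"
  unfolding Gamma_bounds_def
proof (intro ballI allI)
  fix q t assume "q \<in> \<Theta>\<^sub>1 \<times> \<Theta>\<^sub>2"
  then have q: "fst q \<in> \<Theta>\<^sub>1" "snd q \<in> \<Theta>\<^sub>2" by auto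
  define a where "a b = (\<Sum>r\<in>{r\<in>\<Theta>\<^sub>1. h\<^sub>1 r = b}. P\<^sub>1 (fst q) r t)" for b
  define c where "c b = (\<Sum>r\<in>{r\<in>\<Theta>\<^sub>2. h\<^sub>2 r = b}. P\<^sub>2 (snd q) r t)" for b
  have fin: "finite \<Theta>\<^sub>1" "finite \<Theta>\<^sub>2"
    using mc1 mc2 by (simp_all add: markov_chain_def)
  have nonneg: "0 \<le> a b" "0 \<le> c b" for b
    using mc1 mc2 q unfolding a_def c_def by (auto intro!: sum_nonneg simp: markov_chain_def)
  have "a 0 + a 1 = (\<Sum>r\<in>\<Theta>\<^sub>1. P\<^sub>1 (fst q) r t)" "c 0 + c 1 = (\<Sum>r\<in>\<Theta>\<^sub>2. P\<^sub>2 (snd q) r t)"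
    unfolding a_def c_def using fin
    by (subst sum.union_disjoint[symmetric]; auto intro!: sum.cong)+
  then have total: "a 0 + a 1 = 1" "c 0 + c 1 = 1"
    using mc1 mc2 q by (simp_all add: markov_chain_def)
  have bounds: "a 0 \<le> p01" "a 1 \<le> p11" "c 0 \<le> p02" "c 1 \<le> p12"
    using G1 G2 q by (auto simp: a_def c_def Gamma_bounds_def)
  let ?S = "\<lambda>b. {r \<in> \<Theta>\<^sub>1 \<times> \<Theta>\<^sub>2. h\<^sub>1 (fst r) OR h\<^sub>2 (snd r) = b}"
  let ?p = "\<lambda>r. P\<^sub>1 (fst q) (fst r) t * P\<^sub>2 (snd q) (snd r) t"
  have "?S 0 = {r\<in>\<Theta>\<^sub>1. h\<^sub>1 r = 0} \<times> {r\<in>\<Theta>\<^sub>2. h\<^sub>2 r = 0}"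
    \<comment> \<open>\<open>or_bit_def\<close> is removed from the simplifier so that the
      disjunction stays folded and \<open>or_eq_0_iff\<close> applies.\<close>
    by (auto simp: or_eq_0_iff simp del: or_bit_def)
  then have S0: "sum ?p (?S 0) = a 0 * c 0"
    by (simp add: a_def c_def sum_product sum.cartesian_product case_prod_beta)
  have "sum ?p (?S 0) + sum ?p (?S 1) = sum ?p (\<Theta>\<^sub>1 \<times> \<Theta>\<^sub>2)"
    using fin by (subst sum.union_disjoint[symmetric]) (auto intro!: sum.cong)
  also have "\<dots> = (\<Sum>r\<in>\<Theta>\<^sub>1. P\<^sub>1 (fst q) r t) * (\<Sum>r\<in>\<Theta>\<^sub>2. P\<^sub>2 (snd q) r t)"
    by (simp add: sum_product sum.cartesian_product case_prod_beta)
  also have "\<dots> = 1"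
    using mc1 mc2 q by (simp add: markov_chain_def)
  finally have S1: "sum ?p (?S 1) = 1 - a 0 * c 0" using S0 by simp
  have a1: "a 1 = 1 - a 0" and c1: "c 1 = 1 - c 0" using total by auto
  \<comment> \<open>The event that some output is 1 is split in two ways: the first output is 1, or
    it is 0 and the second is 1; and the same with the roles exchanged. Each split yields one of the
    two sums in the minimum.\<close>
  have "1 - a 0 * c 0 = a 1 + a 0 * c 1" "1 - a 0 * c 0 = c 1 + c 0 * a 1"
    unfolding a1 c1 by (simp_all add: algebra_simps)
  \<comment> \<open>Monotonicity of the product also requires nonnegative upper bounds;
    \<open>order_trans\<close> obtains this from the nonnegative sums that they dominate.\<close>
  moreover have "a 0 * c 0 \<le> p01 * p02" "a 0 * c 1 \<le> p01 * p12" "c 0 * a 1 \<le> p02 * p11"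
    using bounds nonneg by (meson mult_mono order_trans)+
  \<comment> \<open>This gives the remaining bound 1 in the minimum.\<close>
  moreover have "0 \<le> a 0 * c 0" using nonneg by simp
  ultimately show "sum ?p (?S 0) \<le> p01 * p02 \<and>
      sum ?p (?S 1) \<le> min (min (p11 + p01 * p12) (p12 + p02 * p11)) 1"
    using S0 S1 bounds by simp
qed

theorem theorem4p2:
  fixes M :: "'w measure" and F :: "nat \<Rightarrow> 'w measure"
    and \<Theta>\<^sub>1 :: "'a set" and \<iota>\<^sub>1 :: "'a \<Rightarrow> real" and P\<^sub>1 :: "'a \<Rightarrow> 'a \<Rightarrow> nat \<Rightarrow> real"
    and \<theta>\<^sub>1 :: "nat \<Rightarrow> 'w \<Rightarrow> 'a" and h\<^sub>1 :: "'a \<Rightarrow> bit" and l\<^sub>1 :: "nat \<Rightarrow> 'w \<Rightarrow> bit"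
    and \<Theta>\<^sub>2 :: "'b set" and \<iota>\<^sub>2 :: "'b \<Rightarrow> real" and P\<^sub>2 :: "'b \<Rightarrow> 'b \<Rightarrow> nat \<Rightarrow> real"
    and \<theta>\<^sub>2 :: "nat \<Rightarrow> 'w \<Rightarrow> 'b" and h\<^sub>2 :: "'b \<Rightarrow> bit" and l\<^sub>2 :: "nat \<Rightarrow> 'w \<Rightarrow> bit"
    and p01 p11 p02 p12 :: real
  assumes "filtered_prob_space M F"
    and "p01 \<in> {0..1}" "p11 \<in> {0..1}" "p02 \<in> {0..1}" "p12 \<in> {0..1}"
    and "hidden_markov_model M F \<Theta>\<^sub>1 \<iota>\<^sub>1 P\<^sub>1 \<theta>\<^sub>1 h\<^sub>1 l\<^sub>1" and "Gamma_bounds \<Theta>\<^sub>1 P\<^sub>1 h\<^sub>1 p01 p11"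
    and "hidden_markov_model M F \<Theta>\<^sub>2 \<iota>\<^sub>2 P\<^sub>2 \<theta>\<^sub>2 h\<^sub>2 l\<^sub>2" and "Gamma_bounds \<Theta>\<^sub>2 P\<^sub>2 h\<^sub>2 p02 p12"
    and "indep_processes M \<Theta>\<^sub>1 \<theta>\<^sub>1 \<Theta>\<^sub>2 \<theta>\<^sub>2"
  defines "p0_tilde \<equiv> p01 * p02"
    and "p1_tilde \<equiv> min (min (p11 + p01 * p12) (p12 + p02 * p11)) 1"
    and "l_tilde \<equiv> (\<lambda>t \<omega>. l\<^sub>1 t \<omega> OR l\<^sub>2 t \<omega>)"
  shows "hmm_output_process M F l_tilde \<and> l_tilde \<in> Gamma_processes M F p0_tilde p1_tilde"
proof -
  have mc: "markov_chain M F \<Theta>\<^sub>1 \<iota>\<^sub>1 P\<^sub>1 \<theta>\<^sub>1" "markov_chain M F \<Theta>\<^sub>2 \<iota>\<^sub>2 P\<^sub>2 \<theta>\<^sub>2"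
    using assms(6,8) by (simp_all add: hidden_markov_model_def)
  have hmm: "hidden_markov_model M F (\<Theta>\<^sub>1 \<times> \<Theta>\<^sub>2) (\<lambda>q. \<iota>\<^sub>1 (fst q) * \<iota>\<^sub>2 (snd q))
      (\<lambda>q r t. P\<^sub>1 (fst q) (fst r) t * P\<^sub>2 (snd q) (snd r) t) (\<lambda>t \<omega>. (\<theta>\<^sub>1 t \<omega>, \<theta>\<^sub>2 t \<omega>))
      (\<lambda>q. h\<^sub>1 (fst q) OR h\<^sub>2 (snd q)) l_tilde"
    using markov_chain_pair[OF assms(1) mc assms(10)] assms(6,8)
    by (simp add: hidden_markov_model_def l_tilde_def)
  have "Gamma_bounds (\<Theta>\<^sub>1 \<times> \<Theta>\<^sub>2) (\<lambda>q r t. P\<^sub>1 (fst q) (fst r) t * P\<^sub>2 (snd q) (snd r) t)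
      (\<lambda>q. h\<^sub>1 (fst q) OR h\<^sub>2 (snd q)) p0_tilde p1_tilde"
    unfolding p0_tilde_def p1_tilde_def by (rule Gamma_bounds_OR[OF mc assms(7,9)])
  \<comment> \<open>The joint states have type \<open>'a \<times> 'b\<close>. The two introduction
    rules encode them as natural numbers, so one model serves both conclusions.\<close>
  then show ?thesis
    using hmm_output_processI[OF assms(1) hmm] Gamma_processesI[OF assms(1) hmm] by blast
qed

end
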